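(* Let $d \geq 0$ be an integer. Then $$\sum_{m, n, k \geq 0} \frac{ q^{ \binom{n+1}{2} + d \binom{n}{2} } }{ (q; q)_n } \cdot \frac{ (-1)^k q^{3k^2 + d \binom{2k}{2}} }{ (q^2; q^2)_{k} } \cdot \frac{ (q^{2k}; q)_m \, q^{ d \binom{m}{2} } (-q)^m }{ (q; q)_m } \cdot x^{ n + 2k + m } \, q^{2dnk + dnm + 2dkm}$$ is the generating function for partitions into positive parts with pairwise difference at least $2+d$. That is, for all integers $l, N \geq 0$, the coefficient of $x^{l} q^{N}$ in this series is the number of partitions $\lambda_1 \leq \lambda_2 \leq \cdots \leq \lambda_l$ of $N$ into exactly $l$ positive parts satisfying $\lambda_j - \lambda_{j-1} \geq 2+d$ for $j = 2, \ldots, l$.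
   Context: All series are formal power series in $x$ and $q$. The $q$-Pochhammer symbols are $(a;q)_n = \prod_{j=1}^{n}(1-aq^{j-1})$, with $(a;q)_0 = 1$; in particular $(q^{0};q)_m = 0$ for $m \geq 1$. The empty partition (of $0$, with $0$ parts) is counted. *)

theory Defs
  imports
    "HOL-Computational_Algebra.Formal_Power_Series"
    "HOL-Analysis.Infinite_Sum"
begin

definition q_pochhammer :: "'a::comm_ring_1 \<Rightarrow> 'a \<Rightarrow> nat \<Rightarrow> 'a" where
  "q_pochhammer a q n = (\<Prod>j=1..n. 1 - a * q ^ (j - 1))"

text \<open>
  Series in \<open>x\<close> and \<open>q\<close> are elements of \<open>\<rat>[[q]][[x]]\<close>: the outer variable is \<open>x\<close>,
  and the coefficient of \<open>x\<^sup>l q\<^sup>N\<close> in \<open>F\<close> is \<open>fps_nth (fps_nth F l) N\<close>.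
\<close>

abbreviation qvar :: "rat fps" where
  "qvar \<equiv> fps_X"

abbreviation xvar :: "rat fps fps" where
  "xvar \<equiv> fps_X"

text \<open>
  The divisions take place in \<open>\<rat>[[q]]\<close>; every denominator has constant term 1, so they are
  exact.
\<close>

definition series_term :: "nat \<Rightarrow> nat \<Rightarrow> nat \<Rightarrow> nat \<Rightarrow> rat fps fps" where
  "series_term d m n k =
     fps_const
       ( qvar ^ (((n + 1) choose 2) + d * (n choose 2)) / q_pochhammer qvar qvar n
       * ((-1) ^ k * qvar ^ (3 * k\<^sup>2 + d * ((2 * k) choose 2)) / q_pochhammer (qvar\<^sup>2) (qvar\<^sup>2) k)
       * (q_pochhammer (qvar ^ (2 * k)) qvar m * qvar ^ (d * (m choose 2)) * (- qvar) ^ m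
           / q_pochhammer qvar qvar m)
       * qvar ^ (2 * d * n * k + d * n * m + 2 * d * k * m))
     * xvar ^ (n + 2 * k + m)"

text \<open>
  Partitions of \<open>N\<close> into exactly \<open>l\<close> positive parts, listed in weakly increasing order, with
  consecutive parts differing by at least \<open>r\<close>. The condition is written additively because
  subtraction on \<^typ>\<open>nat\<close> truncates; list positions start at 0.
\<close>

definition gap_partitions :: "nat \<Rightarrow> nat \<Rightarrow> nat \<Rightarrow> nat list set" where
  "gap_partitions r l N =
     {ps. length ps = l \<and> sum_list ps = N \<and> (\<forall>p\<in>set ps. p > 0) \<and> sorted ps \<and>
          (\<forall>j. 1 \<le> j \<and> j < l \<longrightarrow> ps ! (j - 1) + r \<le> ps ! j)}"

end

theory Submission
  imports Defs
begin

text \<open>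
  Write \<open>l = n + 2k + m\<close>. The six exponents that carry a factor \<open>d\<close> add up to
  \<open>d\<close> times \<open>l choose 2\<close>, so \<open>d\<close> only contributes a monomial depending on \<open>l\<close>, and
  it remains to evaluate the coefficient of \<open>x\<^sup>l\<close> for \<open>d = 0\<close>.

  For fixed \<open>k\<close>, the sum over \<open>n\<close> is Euler's series for \<open>(-xq; q)\<^sub>\<infinity>\<close>, and by the
  q-binomial theorem the sum over \<open>m\<close> is the quotient of \<open>(-xq^(2k+1); q)\<^sub>\<infinity>\<close> by
  \<open>(-xq; q)\<^sub>\<infinity>\<close>. Their product is again an Euler series (\<open>euler_times_q_binomial\<close>).
  After this, the coefficient of \<open>x\<^sup>l\<close> is a single sum over \<open>k\<close>, and completing the
  exponent turns it into a monomial times the coefficient of \<open>y\<^sup>l\<close> in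
  \<open>(y\<^sup>2; q\<^sup>2)\<^sub>\<infinity> / (y; q)\<^sub>\<infinity> = (-y; q)\<^sub>\<infinity>\<close> (\<open>even_euler_times_geometric\<close>).
  The result is \<open>q\<close> to the power \<open>l + (2 + d) (l choose 2)\<close>, divided by \<open>(q; q)\<^sub>l\<close>
  (\<open>sum_term_coeff\<close>).

  On the combinatorial side, partitions into \<open>l\<close> parts with gaps at least \<open>r\<close> have the
  generating function \<open>q\<close> to the power \<open>l + r (l choose 2)\<close>, divided by \<open>(q; q)\<^sub>l\<close>
  (\<open>gap_partitions_gf\<close>): either every part exceeds 1 and 1 is subtracted from each, or
  the smallest part is 1 and is removed.

  The infinite products are never formed. Each series is characterised by its constant
  term and a first-order equation
  \<open>(1 - \<alpha>z) f(z) = (1 - \<beta>z) f(qz)\<close>, which is what the quotient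
  \<open>(\<beta>z; q)\<^sub>\<infinity> / (\<alpha>z; q)\<^sub>\<infinity>\<close> satisfies; product identities become cancellations
  between such equations.
\<close>

section \<open>First-order q-difference equations\<close>

definition dilate :: "'a::comm_ring_1 \<Rightarrow> 'a fps \<Rightarrow> 'a fps" where
  "dilate q f = Abs_fps (\<lambda>n. q ^ n * fps_nth f n)"

text \<open>
  The equation of the quotient \<open>(\<beta>z; q)\<^sub>\<infinity> / (\<alpha>z; q)\<^sub>\<infinity>\<close>.
\<close>

definition qdiff :: "'a::comm_ring_1 \<Rightarrow> 'a \<Rightarrow> 'a \<Rightarrow> 'a fps \<Rightarrow> bool" where
  "qdiff q \<alpha> \<beta> f \<longleftrightarrow>
     (1 - fps_const \<alpha> * fps_X) * f = (1 - fps_const \<beta> * fps_X) * dilate q f"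

lemma dilate_nth [simp]: "fps_nth (dilate q f) n = q ^ n * fps_nth f n"
  by (simp add: dilate_def)

lemma dilate_mult:
  fixes f g :: "'a::idom fps"
  shows "dilate q (f * g) = dilate q f * dilate q g"
  using fps_compose_mult_distrib[of "fps_const q * fps_X" f g]
  by (simp add: fps_compose_linear dilate_def)

lemma forall_nat_split: "(\<forall>n. P n) \<longleftrightarrow> P 0 \<and> (\<forall>n. P (Suc n))"
  by (metis not0_implies_Suc)

lemma qdiff_iff_nth:
  "qdiff q \<alpha> \<beta> f \<longleftrightarrow>
     (\<forall>n. (1 - q ^ Suc n) * fps_nth f (Suc n) = (\<alpha> - \<beta> * q ^ n) * fps_nth f n)"
proof -
  have "fps_nth ((1 - fps_const c * fps_X) * g) n =
      fps_nth g n - (case n of 0 \<Rightarrow> 0 | Suc k \<Rightarrow> c * fps_nth g k)" for c :: 'a and g n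
    by (simp add: left_diff_distrib mult.assoc split: nat.split)
  then have "qdiff q \<alpha> \<beta> f \<longleftrightarrow>
      (\<forall>n. fps_nth f n - (case n of 0 \<Rightarrow> 0 | Suc k \<Rightarrow> \<alpha> * fps_nth f k) =
           q ^ n * fps_nth f n - (case n of 0 \<Rightarrow> 0 | Suc k \<Rightarrow> \<beta> * (q ^ k * fps_nth f k)))"
    by (simp add: qdiff_def fps_eq_iff cong: nat.case_cong)
  also have "\<dots> \<longleftrightarrow>
      (\<forall>n. fps_nth f (Suc n) - \<alpha> * fps_nth f n =
           q ^ Suc n * fps_nth f (Suc n) - \<beta> * (q ^ n * fps_nth f n))"
    by (subst forall_nat_split) simp
  also have "\<dots> \<longleftrightarrow>
      (\<forall>n. (1 - q ^ Suc n) * fps_nth f (Suc n) = (\<alpha> - \<beta> * q ^ n) * fps_nth f n)"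
    by (simp add: algebra_simps)
  finally show ?thesis .
qed

lemma one_minus_const_X_neq_0: "1 - fps_const c * fps_X \<noteq> (0 :: 'a::comm_ring_1 fps)"
proof
  assume "1 - fps_const c * fps_X = (0 :: 'a fps)"
  then have "fps_nth (1 - fps_const c * fps_X :: 'a fps) 0 = 0" by simp
  then show False by simp
qed

text \<open>
  The factor \<open>1 - \<beta>z\<close> cancels, as the corresponding infinite product would in
  \<open>(\<beta>z)\<^sub>\<infinity> / (\<alpha>z)\<^sub>\<infinity> \<cdot> (\<gamma>z)\<^sub>\<infinity> / (\<beta>z)\<^sub>\<infinity>\<close>.
\<close>

lemma qdiff_mult:
  fixes f g :: "'a::idom fps"
  assumes f: "qdiff q \<alpha> \<beta> f" and g: "qdiff q \<beta> \<gamma> g"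
  shows "qdiff q \<alpha> \<gamma> (f * g)"
proof -
  let ?L = "\<lambda>c :: 'a. 1 - fps_const c * fps_X"
  have "?L \<beta> * (?L \<alpha> * (f * g)) = (?L \<alpha> * f) * (?L \<beta> * g)"
    by (simp only: ac_simps)
  also have "\<dots> = (?L \<beta> * dilate q f) * (?L \<gamma> * dilate q g)"
    using f g by (simp only: qdiff_def)
  also have "\<dots> = ?L \<beta> * (?L \<gamma> * dilate q (f * g))"
    by (simp only: dilate_mult ac_simps)
  finally show ?thesis
    unfolding qdiff_def using one_minus_const_X_neq_0 by (metis mult_left_cancel)
qed

lemma qdiff_unique:
  fixes f g :: "'a::idom fps"
  assumes "qdiff q \<alpha> \<beta> f" "qdiff q \<alpha> \<beta> g"
    and "fps_nth f 0 = fps_nth g 0"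
    and q: "\<And>n. q ^ Suc n \<noteq> 1"
  shows "f = g"
proof (rule fps_ext)
  fix n show "fps_nth f n = fps_nth g n"
  proof (induction n)
    case (Suc n)
    then have "(1 - q ^ Suc n) * fps_nth f (Suc n) = (1 - q ^ Suc n) * fps_nth g (Suc n)"
      using assms(1,2) by (simp only: qdiff_iff_nth)
    then show ?case using q[of n] by simp
  qed (use assms in simp)
qed

section \<open>Euler's series and the q-binomial series\<close>

lemma choose_two_Suc: "Suc n choose 2 = (n choose 2) + n"
  by (simp add: numeral_2_eq_2)

lemma choose_two_add: "(a + b) choose 2 = (a choose 2) + (b choose 2) + a * b"
  by (induction b) (simp_all add: choose_two_Suc)

lemma choose_two_square: "n\<^sup>2 = 2 * (n choose 2) + n"
  by (induction n) (simp_all add: choose_two_Suc power2_eq_square)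

lemma q_pochhammer_0 [simp]: "q_pochhammer a q 0 = 1"
  by (simp add: q_pochhammer_def)

lemma q_pochhammer_Suc: "q_pochhammer a q (Suc n) = q_pochhammer a q n * (1 - a * q ^ n)"
  by (simp add: q_pochhammer_def)

lemma q_pochhammer_zero [simp]: "q_pochhammer 0 q n = 1"
  by (simp add: q_pochhammer_def)

lemma q_pochhammer_nth_0:
  "fps_nth a 0 = 0 \<Longrightarrow> fps_nth (q_pochhammer a q n) 0 = 1"
  by (induction n) (simp_all add: q_pochhammer_Suc)

lemma divide_q_pochhammer:
  fixes a :: "'a::field fps"
  assumes "fps_nth a 0 = 0"
  shows "f / q_pochhammer a q n = f * inverse (q_pochhammer a q n)"
  by (simp add: assms q_pochhammer_nth_0 fps_divide_unit)

text \<open>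
  All recurrences in \<open>n\<close> below come from this step: multiplying by the last factor of the
  denominator lowers its index.
\<close>

lemma divide_q_pochhammer_Suc:
  fixes a :: "'a::field fps"
  assumes "fps_nth a 0 = 0"
  shows "(1 - a * q ^ n) * (f / q_pochhammer a q (Suc n)) = f / q_pochhammer a q n"
proof -
  have "(1 - a * q ^ n) * inverse (1 - a * q ^ n) = 1"
    by (rule inverse_mult_eq_1') (simp add: assms)
  moreover have "f / q_pochhammer a q (Suc n) =
      f / q_pochhammer a q n * inverse (1 - a * q ^ n)"
    unfolding divide_q_pochhammer[OF assms]
    by (simp only: q_pochhammer_Suc fps_inverse_mult mult.assoc)
  ultimately show ?thesis
    by (simp only: mult.left_commute[of "1 - a * q ^ n"] mult_1_right)
qed

lemma qvar_power_neq_1: "qvar ^ Suc n \<noteq> 1"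
proof
  assume "qvar ^ Suc n = 1"
  then have "fps_nth (qvar ^ Suc n) 0 = fps_nth (1 :: rat fps) 0" by (rule arg_cong)
  then show False by simp
qed

text \<open>This is the expansion of \<open>(-cz; q)\<^sub>\<infinity>\<close>.\<close>

definition euler_series :: "rat fps \<Rightarrow> rat fps fps" where
  "euler_series c = Abs_fps (\<lambda>n. qvar ^ (n choose 2) * c ^ n / q_pochhammer qvar qvar n)"

text \<open>
  By the q-binomial theorem this is \<open>(acz; q)\<^sub>\<infinity> / (cz; q)\<^sub>\<infinity>\<close>; the case \<open>a = 0\<close>,
  \<open>c = 1\<close> is \<open>1 / (z; q)\<^sub>\<infinity>\<close>.
\<close>

definition q_binomial_series :: "rat fps \<Rightarrow> rat fps \<Rightarrow> rat fps fps" where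
  "q_binomial_series a c =
     Abs_fps (\<lambda>n. q_pochhammer a qvar n * c ^ n / q_pochhammer qvar qvar n)"

lemma qdiff_euler_series: "qdiff qvar 0 (- c) (euler_series c)"
  unfolding qdiff_iff_nth
proof
  fix n
  have "(1 - qvar ^ Suc n) * fps_nth (euler_series c) (Suc n) =
      qvar ^ (Suc n choose 2) * c ^ Suc n / q_pochhammer qvar qvar n"
    using divide_q_pochhammer_Suc[of qvar qvar n] by (simp add: euler_series_def)
  also have "\<dots> = (0 - - c * qvar ^ n) * fps_nth (euler_series c) n"
    by (simp add: euler_series_def divide_q_pochhammer choose_two_Suc power_add mult_ac)
  finally show "(1 - qvar ^ Suc n) * fps_nth (euler_series c) (Suc n) =
      (0 - - c * qvar ^ n) * fps_nth (euler_series c) n" .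
qed

lemma qdiff_q_binomial_series: "qdiff qvar c (a * c) (q_binomial_series a c)"
  unfolding qdiff_iff_nth
proof
  fix n
  have "(1 - qvar ^ Suc n) * fps_nth (q_binomial_series a c) (Suc n) =
      q_pochhammer a qvar (Suc n) * c ^ Suc n / q_pochhammer qvar qvar n"
    using divide_q_pochhammer_Suc[of qvar qvar n] by (simp add: q_binomial_series_def)
  also have "\<dots> = (c - a * c * qvar ^ n) * fps_nth (q_binomial_series a c) n"
    by (simp add: q_binomial_series_def divide_q_pochhammer q_pochhammer_Suc algebra_simps)
  finally show "(1 - qvar ^ Suc n) * fps_nth (q_binomial_series a c) (Suc n) =
      (c - a * c * qvar ^ n) * fps_nth (q_binomial_series a c) n" .
qed

text \<open>
  In terms of products, \<open>(-cz)\<^sub>\<infinity> \<cdot> (-acz)\<^sub>\<infinity> / (-cz)\<^sub>\<infinity> = (-acz)\<^sub>\<infinity>\<close>. With \<open>c = q\<close> and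
  \<open>a = q^(2k)\<close> it carries out the summation over \<open>n\<close> and \<open>m\<close>.
\<close>

lemma euler_times_q_binomial:
  "euler_series c * q_binomial_series a (- c) = euler_series (a * c)"
proof (rule qdiff_unique)
  show "qdiff qvar 0 (- (a * c)) (euler_series c * q_binomial_series a (- c))"
    using qdiff_mult[OF qdiff_euler_series qdiff_q_binomial_series[of "- c" a]] by simp
qed (simp_all only: qdiff_euler_series qvar_power_neq_1 not_False_eq_True,
     simp add: euler_series_def q_binomial_series_def)

text \<open>
  The expansion of \<open>(z\<^sup>2; q\<^sup>2)\<^sub>\<infinity>\<close>: Euler's series with base \<open>q\<^sup>2\<close> at \<open>-z\<^sup>2\<close>. It satisfies
  \<open>f(z) = (1 - z\<^sup>2) f(qz)\<close>, which is not one of the equations \<open>qdiff\<close>.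
\<close>

definition even_euler_series :: "rat fps fps" where
  "even_euler_series = Abs_fps (\<lambda>n. if even n
     then (-1) ^ (n div 2) * qvar ^ (2 * (n div 2 choose 2))
            / q_pochhammer (qvar\<^sup>2) (qvar\<^sup>2) (n div 2)
     else 0)"

lemma even_euler_series_dilate:
  "even_euler_series = (1 - fps_X\<^sup>2) * dilate qvar even_euler_series"
proof (rule fps_ext)
  fix n
  let ?A = even_euler_series
  have rhs: "fps_nth ((1 - fps_X\<^sup>2) * dilate qvar ?A) n =
      qvar ^ n * fps_nth ?A n - (if n < 2 then 0 else qvar ^ (n - 2) * fps_nth ?A (n - 2))"
    by (simp add: left_diff_distrib fps_X_power_mult_nth)
  show "fps_nth ?A n = fps_nth ((1 - fps_X\<^sup>2) * dilate qvar ?A) n"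
  proof (cases "odd n \<or> n = 0")
    case True
    then show ?thesis unfolding rhs by (auto simp: even_euler_series_def)
  next
    case False
    then obtain k where n: "n = 2 * Suc k"
      by (metis evenE not0_implies_Suc mult_0_right)
    have "(1 - qvar ^ n) * fps_nth ?A n =
        (1 - qvar\<^sup>2 * (qvar\<^sup>2) ^ k) * ((-1) ^ Suc k * qvar ^ (2 * (Suc k choose 2))
          / q_pochhammer (qvar\<^sup>2) (qvar\<^sup>2) (Suc k))"
      by (simp add: n even_euler_series_def power_mult power_add power2_eq_square)
    also have "\<dots> = (-1) ^ Suc k * qvar ^ (2 * (Suc k choose 2))
          / q_pochhammer (qvar\<^sup>2) (qvar\<^sup>2) k"
      by (rule divide_q_pochhammer_Suc) simp
    also have "\<dots> = - (qvar ^ (n - 2) * fps_nth ?A (n - 2))"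
      by (simp add: n even_euler_series_def divide_q_pochhammer choose_two_Suc power_add
          distrib_left mult_ac)
    finally show ?thesis unfolding rhs using n by (simp add: algebra_simps)
  qed
qed

text \<open>
  This is \<open>(y\<^sup>2; q\<^sup>2)\<^sub>\<infinity> / (y; q)\<^sub>\<infinity> = (-y; q)\<^sub>\<infinity>\<close>. The factor \<open>1 - y\<^sup>2\<close> from the
  numerator and \<open>1 - y\<close> from the denominator leave \<open>1 + y\<close>, the factor of Euler's series.
\<close>

lemma even_euler_times_geometric:
  "even_euler_series * q_binomial_series 0 1 = euler_series 1"
proof (rule qdiff_unique)
  let ?A = even_euler_series and ?H = "q_binomial_series 0 1"
  have H: "(1 - fps_X) * ?H = dilate qvar ?H"
    using qdiff_q_binomial_series[of 1 0] by (simp add: qdiff_def)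
  have "(1 - fps_X) * (?A * ?H) = ?A * ((1 - fps_X) * ?H)"
    by (simp only: ac_simps)
  also have "\<dots> = (1 - fps_X\<^sup>2) * dilate qvar ?A * dilate qvar ?H"
    unfolding H using even_euler_series_dilate by simp
  also have "\<dots> = (1 - fps_X) * ((1 + fps_X) * dilate qvar (?A * ?H))"
    by (simp add: dilate_mult algebra_simps power2_eq_square)
  finally have "?A * ?H = (1 + fps_X) * dilate qvar (?A * ?H)"
    using one_minus_const_X_neq_0[of "1 :: rat fps"] by simp
  then show "qdiff qvar 0 (- 1) (?A * ?H)"
    by (simp add: qdiff_def flip: fps_const_neg)
qed (simp_all only: qdiff_euler_series qvar_power_neq_1 not_False_eq_True,
     simp add: euler_series_def q_binomial_series_def even_euler_series_def numeral_2_eq_2)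

section \<open>The coefficients of the triple sum\<close>

text \<open>
  The coefficient of a summand, with the powers depending on \<open>d\<close> collected and the factors
  in \<open>n\<close> and \<open>m\<close> written as coefficients of series, so that fixing \<open>k\<close> and
  \<open>n + m\<close> yields a Cauchy product.
\<close>

definition term_coeff :: "nat \<Rightarrow> nat \<Rightarrow> nat \<Rightarrow> nat \<Rightarrow> rat fps" where
  "term_coeff d m n k = qvar ^ (d * ((n + 2 * k + m) choose 2))
     * ((-1) ^ k * qvar ^ (3 * k\<^sup>2) / q_pochhammer (qvar\<^sup>2) (qvar\<^sup>2) k)
     * (fps_nth (euler_series qvar) n * fps_nth (q_binomial_series (qvar ^ (2 * k)) (- qvar)) m)"

lemma series_term_eq:
  "series_term d m n k = fps_const (term_coeff d m n k) * xvar ^ (n + 2 * k + m)"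
proof -
  have e: "d * ((n + 2 * k + m) choose 2) =
      d * (n choose 2) + d * ((2 * k) choose 2) + d * (m choose 2)
       + (2 * d * n * k + d * n * m + 2 * d * k * m)"
    by (simp add: choose_two_add algebra_simps)
  show ?thesis
    unfolding series_term_def term_coeff_def e euler_series_def q_binomial_series_def
    by (simp add: divide_q_pochhammer choose_two_Suc power_add mult_ac)
qed

lemma finite_triples_of_degree: "finite {(m, n, k). n + 2 * k + m = (l::nat)}"
  by (rule finite_subset[of _ "{..l} \<times> {..l} \<times> {..l}"]) auto

lemma sum_triples_of_degree:
  fixes f :: "nat \<Rightarrow> nat \<Rightarrow> nat \<Rightarrow> 'a::comm_monoid_add"
  shows "(\<Sum>(m, n, k) | n + 2 * k + m = l. f m n k) =
    (\<Sum>k = 0..l div 2. \<Sum>n = 0..l - 2 * k. f (l - 2 * k - n) n k)"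
proof -
  have "(\<Sum>(m, n, k) | n + 2 * k + m = l. f m n k) =
      (\<Sum>(k, n)\<in>(SIGMA k:{0..l div 2}. {0..l - 2 * k}). f (l - 2 * k - n) n k)"
    by (rule sum.reindex_bij_witness[where j = "\<lambda>(m, n, k). (k, n)"
          and i = "\<lambda>(k, n). (l - 2 * k - n, n, k)"]) auto
  then show ?thesis by (simp add: sum.Sigma)
qed

lemma even_euler_times_nth:
  "fps_nth (even_euler_series * g) l =
     (\<Sum>k = 0..l div 2. fps_nth even_euler_series (2 * k) * fps_nth g (l - 2 * k))"
proof -
  have "fps_nth (even_euler_series * g) l =
      (\<Sum>i\<in>(\<lambda>k. 2 * k) ` {0..l div 2}. fps_nth even_euler_series i * fps_nth g (l - i))"
    unfolding fps_mult_nth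
    by (rule sum.mono_neutral_right) (auto simp: even_euler_series_def image_iff elim!: evenE)
  then show ?thesis by (simp add: sum.reindex inj_on_def)
qed

lemma sum_term_coeff:
  "(\<Sum>(m, n, k) | n + 2 * k + m = l. term_coeff d m n k) =
     qvar ^ (l + (2 + d) * (l choose 2)) / q_pochhammer qvar qvar l"
proof -
  have inner: "(\<Sum>n = 0..l - 2 * k. term_coeff d (l - 2 * k - n) n k) =
      qvar ^ (d * (l choose 2) + (Suc l choose 2)) *
        (fps_nth even_euler_series (2 * k) * fps_nth (q_binomial_series 0 1) (l - 2 * k))"
    if "k \<in> {0..l div 2}" for k
  proof -
    define j where "j = l - 2 * k"
    have l: "l = 2 * k + j" using that by (simp add: j_def)
    have "(\<Sum>n = 0..j. term_coeff d (j - n) n k) =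
        qvar ^ (d * (l choose 2)) *
          ((-1) ^ k * qvar ^ (3 * k\<^sup>2) / q_pochhammer (qvar\<^sup>2) (qvar\<^sup>2) k) *
          fps_nth (euler_series qvar * q_binomial_series (qvar ^ (2 * k)) (- qvar)) j"
      unfolding fps_mult_nth sum_distrib_left
      by (rule sum.cong) (simp_all add: term_coeff_def l ac_simps)
    also have "\<dots> = qvar ^ (d * (l choose 2)) *
          ((-1) ^ k * qvar ^ (3 * k\<^sup>2) / q_pochhammer (qvar\<^sup>2) (qvar\<^sup>2) k) *
          (qvar ^ (2 * k * j + (Suc j choose 2)) / q_pochhammer qvar qvar j)"
      unfolding euler_times_q_binomial
      by (simp add: euler_series_def choose_two_Suc power_mult_distrib power_add ac_simps
          flip: power_mult)
    also have "\<dots> = qvar ^ (d * (l choose 2) + (3 * k\<^sup>2 + 2 * k * j + (Suc j choose 2))) *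
        ((-1) ^ k * inverse (q_pochhammer (qvar\<^sup>2) (qvar\<^sup>2) k)
          * inverse (q_pochhammer qvar qvar j))"
      by (simp add: divide_q_pochhammer power_add ac_simps)
    (* Completing the exponent: what remains after the part depending on l only is the
       exponent in the series of even powers. *)
    also have "3 * k\<^sup>2 + 2 * k * j + (Suc j choose 2) = (Suc l choose 2) + 2 * (k choose 2)"
    proof -
      have "(2 * k) choose 2 = 2 * (k choose 2) + k\<^sup>2"
        using choose_two_add[of k k] by (simp add: mult_2 power2_eq_square)
      then show ?thesis
        using choose_two_square[of k] by (simp add: l choose_two_Suc choose_two_add)
    qed
    finally show ?thesis
      by (simp add: j_def even_euler_series_def q_binomial_series_def divide_q_pochhammer
          power_add ac_simps)
  qed
  have "(\<Sum>(m, n, k) | n + 2 * k + m = l. term_coeff d m n k) =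
      qvar ^ (d * (l choose 2) + (Suc l choose 2)) *
        fps_nth (even_euler_series * q_binomial_series 0 1) l"
    unfolding sum_triples_of_degree even_euler_times_nth sum_distrib_left
    by (rule sum.cong[OF refl inner])
  also have "\<dots> = qvar ^ (d * (l choose 2) + (Suc l choose 2) + (l choose 2))
      / q_pochhammer qvar qvar l"
    unfolding even_euler_times_geometric
    by (simp add: euler_series_def divide_q_pochhammer power_add ac_simps)
  also have "d * (l choose 2) + (Suc l choose 2) + (l choose 2) = l + (2 + d) * (l choose 2)"
    by (simp add: choose_two_Suc)
  finally show ?thesis .
qed

text \<open>
  A family of monomials with finitely many members in each degree is summable: the topology
  on power series compares coefficients, and each coefficient of a partial sum is constant
  once the finitely many summands of that degree are included.
\<close>

lemma has_sum_fps_graded: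
  fixes c :: "'i \<Rightarrow> 'a::ring_1"
  assumes fin: "\<And>l. finite {t. deg t = l}"
  shows "((\<lambda>t. fps_const (c t) * fps_X ^ deg t) has_sum Abs_fps (\<lambda>l. \<Sum>t | deg t = l. c t)) UNIV"
  unfolding has_sum_def
proof (rule tendsto_fpsI)
  fix l
  let ?f = "\<lambda>t. fps_const (c t) * fps_X ^ deg t"
  have "fps_nth (sum ?f Y) l = (\<Sum>t | deg t = l. c t)"
    if "finite Y" "{t. deg t = l} \<subseteq> Y" for Y
  proof -
    have "fps_nth (sum ?f Y) l = (\<Sum>t\<in>Y. if deg t = l then c t else 0)"
      by (auto simp: fps_sum_nth intro!: sum.cong)
    also have "\<dots> = (\<Sum>t | deg t = l. c t)"
      using that by (intro sum.mono_neutral_cong_right) auto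
    finally show ?thesis .
  qed
  then show "eventually (\<lambda>Y. fps_nth (sum ?f Y) l =
      fps_nth (Abs_fps (\<lambda>l. \<Sum>t | deg t = l. c t)) l) (finite_subsets_at_top UNIV)"
    unfolding eventually_finite_subsets_at_top
    by (intro exI[of _ "{t. deg t = l}"]) (simp add: fin)
qed

section \<open>Partitions with prescribed gaps\<close>

lemma gap_partitions_iff:
  "ps \<in> gap_partitions r l N \<longleftrightarrow>
     length ps = l \<and> sum_list ps = N \<and> (\<forall>p\<in>set ps. p > 0) \<and>
     successively (\<lambda>a b. a + r \<le> b) ps"
proof -
  have "successively (\<lambda>a b. a + r \<le> b) ps \<longleftrightarrow>
      (\<forall>j. Suc j < length ps \<longrightarrow> ps ! j + r \<le> ps ! Suc j)"
  proof (induction ps rule: induct_list012)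
    case (3 x y zs)
    then show ?case by (subst forall_nat_split) simp
  qed auto
  moreover have "(\<forall>j. 1 \<le> j \<and> j < length ps \<longrightarrow> ps ! (j - 1) + r \<le> ps ! j) \<longleftrightarrow>
      (\<forall>j. Suc j < length ps \<longrightarrow> ps ! j + r \<le> ps ! Suc j)"
    by (subst forall_nat_split) simp
  moreover have "sorted ps" if "successively (\<lambda>a b. a + r \<le> b) ps"
  proof -
    have "successively (\<le>) ps" using that by (rule successively_mono) auto
    then show ?thesis by (simp add: successively_conv_sorted_wrt)
  qed
  ultimately show ?thesis by (auto simp: gap_partitions_def)
qed

lemma finite_gap_partitions: "finite (gap_partitions r l N)"
  by (rule finite_subset[OF _ finite_lists_length_eq[of "{..N}" l]])
     (auto simp: gap_partitions_iff member_le_sum_list)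

lemma sum_list_map_plus: "sum_list (map (\<lambda>p. p + c) ps) = sum_list ps + c * length ps"
  for c :: nat
  by (induction ps) simp_all

lemma map_plus_gap_partitions:
  assumes "c * l \<le> N"
  shows "map (\<lambda>p. p + c) ` gap_partitions r l (N - c * l) =
    {ps \<in> gap_partitions r l N. \<forall>p\<in>set ps. c < p}"
proof (intro set_eqI iffI)
  fix ps
  assume "ps \<in> {ps \<in> gap_partitions r l N. \<forall>p\<in>set ps. c < p}"
  then have ps: "ps \<in> gap_partitions r l N" and gt: "\<And>p. p \<in> set ps \<Longrightarrow> c < p" by auto
  define qs where "qs = map (\<lambda>p. p - c) ps"
  have eq: "ps = map (\<lambda>p. p + c) qs"
    using gt by (simp add: qs_def less_imp_le map_idI)
  have "\<forall>p\<in>set qs. p > 0" using gt by (auto simp: qs_def)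
  then have "qs \<in> gap_partitions r l (N - c * l)"
    using ps unfolding eq by (auto simp: gap_partitions_iff successively_map sum_list_map_plus)
  then show "ps \<in> map (\<lambda>p. p + c) ` gap_partitions r l (N - c * l)"
    using eq by blast
qed (use assms in \<open>auto simp: gap_partitions_iff successively_map sum_list_map_plus\<close>)

lemma card_map_plus_gap_partitions:
  "card {ps \<in> gap_partitions r l N. \<forall>p\<in>set ps. c < p} =
     (if c * l \<le> N then card (gap_partitions r l (N - c * l)) else 0)"
proof (cases "c * l \<le> N")
  case True
  have inj: "inj (map (\<lambda>p. p + c))" by (rule inj_mapI) (simp add: inj_def)
  then show ?thesis
    using True card_image[OF inj_on_subset[OF inj subset_UNIV]]
    by (simp only: if_True flip: map_plus_gap_partitions)
next
  case False
  have "c * length ps \<le> sum_list ps" if "\<forall>p\<in>set ps. c < p" for ps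
    using that by (induction ps) auto
  then have "{ps \<in> gap_partitions r l N. \<forall>p\<in>set ps. c < p} = {}"
    using False by (auto simp: gap_partitions_iff)
  then show ?thesis by (simp only: False if_False card.empty)
qed

lemma gap_partitions_smallest_one:
  "{ps \<in> gap_partitions r (Suc l) N. hd ps = 1} =
     (if N = 0 then {} else (#) 1 ` {ps \<in> gap_partitions r l (N - 1). \<forall>p\<in>set ps. r < p})"
proof -
  have tail: "ps = [] \<or> r < hd ps \<longleftrightarrow> (\<forall>p\<in>set ps. r < p)"
    if "successively (\<lambda>a b. a + r \<le> b) ps" for ps
  proof -
    have "successively (\<le>) ps" using that by (rule successively_mono) auto
    then have "sorted ps" by (simp add: successively_conv_sorted_wrt)
    then show ?thesis by (cases ps) auto
  qed
  then show ?thesis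
    by (auto simp: gap_partitions_iff length_Suc_conv successively_Cons image_iff
        Suc_le_eq) (use tail in blast)+
qed

text \<open>
  The two summands count the partitions without and with a part equal to 1. In the latter
  case the parts left after removing 1 exceed \<open>r\<close>, so \<open>r\<close> can be subtracted from each.
\<close>

lemma card_gap_partitions_Suc:
  "card (gap_partitions r (Suc l) N) =
     (if Suc l \<le> N then card (gap_partitions r (Suc l) (N - Suc l)) else 0) +
     (if Suc (r * l) \<le> N then card (gap_partitions r l (N - Suc (r * l))) else 0)"
proof -
  let ?G = "gap_partitions r (Suc l) N"
  let ?L = "{ps \<in> ?G. \<forall>p\<in>set ps. 1 < p}" and ?S = "{ps \<in> ?G. hd ps = 1}"
  have sorted: "sorted ps" "length ps = Suc l" "\<forall>p\<in>set ps. p > 0" if "ps \<in> ?G" for ps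
    using that by (simp_all add: gap_partitions_def)
  have "ps \<in> ?L \<union> ?S" if "ps \<in> ?G" for ps
    using sorted[OF that] that by (cases ps) force+
  then have G: "?G = ?L \<union> ?S" by blast
  have "?L \<inter> ?S = {}"
    using sorted by (auto dest!: hd_in_set) (metis hd_in_set less_irrefl list.size(3) nat.simps(3))
  then have "card ?G = card ?L + card ?S"
    by (subst G, subst card_Un_disjoint) (auto simp: finite_gap_partitions)
  moreover have "card ?L = (if Suc l \<le> N then card (gap_partitions r (Suc l) (N - Suc l)) else 0)"
    using card_map_plus_gap_partitions[of r "Suc l" N 1] by simp
  moreover have "card ?S =
      (if Suc (r * l) \<le> N then card (gap_partitions r l (N - Suc (r * l))) else 0)"
    unfolding gap_partitions_smallest_one
    by (cases N) (simp_all add: card_image card_map_plus_gap_partitions)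
  ultimately show ?thesis by simp
qed

lemma gap_partitions_gf:
  "Abs_fps (\<lambda>N. of_nat (card (gap_partitions r l N))) =
     qvar ^ (l + r * (l choose 2)) / q_pochhammer qvar qvar l"
proof (induction l)
  case 0
  have "gap_partitions r 0 N = (if N = 0 then {[]} else {})" for N
    by (auto simp: gap_partitions_iff)
  then show ?case by (auto simp: fps_eq_iff numeral_2_eq_2)
next
  case (Suc l)
  let ?P = "\<lambda>l. Abs_fps (\<lambda>N. of_nat (card (gap_partitions r l N))) :: rat fps"
  have "?P (Suc l) = qvar ^ Suc l * ?P (Suc l) + qvar ^ Suc (r * l) * ?P l"
    unfolding fps_eq_iff fps_add_nth fps_X_power_mult_nth
    by (subst card_gap_partitions_Suc) (auto simp: not_le)
  then have "(1 - qvar ^ Suc l) * ?P (Suc l) = qvar ^ Suc (r * l) * ?P l"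
    by (simp add: algebra_simps)
  also have "\<dots> = qvar ^ (Suc l + r * (Suc l choose 2)) / q_pochhammer qvar qvar l"
    unfolding Suc.IH
    by (simp add: divide_q_pochhammer choose_two_Suc power_add distrib_left mult_ac)
  also have "\<dots> = (1 - qvar ^ Suc l) *
      (qvar ^ (Suc l + r * (Suc l choose 2)) / q_pochhammer qvar qvar (Suc l))"
    using divide_q_pochhammer_Suc[of qvar qvar l] by simp
  finally show ?case
    using qvar_power_neq_1[of l] by simp
qed

theorem mainTheorem2:
  fixes d :: nat
  shows "(\<lambda>(m, n, k). series_term d m n k) summable_on UNIV \<and>
         (\<forall>l N. fps_nth (fps_nth (\<Sum>\<^sub>\<infinity>(m, n, k)\<in>UNIV. series_term d m n k) l) N
                = of_nat (card (gap_partitions (2 + d) l N)))"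
proof -
  let ?deg = "\<lambda>(m, n, k). n + 2 * k + m :: nat"
  let ?S = "Abs_fps (\<lambda>l. \<Sum>(m, n, k) | n + 2 * k + m = l. term_coeff d m n k)"
  have deg: "{t. ?deg t = l} = {(m, n, k). n + 2 * k + m = l}" for l
    by auto
  have "((\<lambda>t. fps_const ((\<lambda>(m, n, k). term_coeff d m n k) t) * fps_X ^ ?deg t)
      has_sum Abs_fps (\<lambda>l. \<Sum>t | ?deg t = l. (\<lambda>(m, n, k). term_coeff d m n k) t)) UNIV"
    by (rule has_sum_fps_graded) (simp add: deg finite_triples_of_degree)
  then have sum: "((\<lambda>(m, n, k). series_term d m n k) has_sum ?S) UNIV"
    by (simp add: series_term_eq deg case_prod_unfold)
  have "fps_nth (fps_nth ?S l) N = of_nat (card (gap_partitions (2 + d) l N))" for l N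
    using gap_partitions_gf[of "2 + d" l] by (simp add: sum_term_coeff fps_eq_iff)
  then show ?thesis
    using sum infsumI[OF sum] by (auto simp: summable_on_def)
qed

end
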